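(* Let $(A_n)_{n\in\mathbb{Z}}$ be a Somos 4 sequence, defined by $$A_{n+4}A_n=\alpha\,A_{n+3}A_{n+1}+\beta\,(A_{n+2})^2$$ with non-zero initial data $A_1,A_2,A_3,A_4$. Suppose that $\alpha,\beta\in\mathbb{Z}$, that the eight successive terms $A_{-2},A_{-1},A_0,A_1,A_2,A_3,A_4,A_5$ are integers, and that $$\gcd(\alpha,\beta)=\gcd(A_1,A_2)=\gcd(\alpha,A_0,A_2)=\gcd(\alpha,A_1,A_3)=1 .$$ Then $A_n\in\mathbb{Z}$ for all $n\in\mathbb{Z}$.
   Context: The recurrence is iterated forwards and backwards from the four non-zero values $A_1,\dots,A_4$, giving a sequence indexed by $\mathbb{Z}$. Convention on zeros: if a zero term is encountered, the sequence is analytically continued through it. That is, $A_n$ is by definition the value at the given data of the rational function of $\alpha,\beta,A_1,A_2,A_3,A_4$ obtained by iterating the recurrence formally with these six quantities as indeterminates; it is known (the Laurent property of Fomin and Zelevinsky) that this rational function lies in $\mathbb{Z}[\alpha,\beta,A_1^{\pm1},A_2^{\pm1},A_3^{\pm1},A_4^{\pm1}]$, so its value is well defined whenever $A_1,A_2,A_3,A_4$ are non-zero. *)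

theory Defs
  imports "HOL-Computational_Algebra.Computational_Algebra"
begin

text \<open>
  The sequence defined by s(n+4) s(n) = a s(n+3) s(n+1) + b s(n+2)^2 with s(0), ..., s(3) given.
  Since \<open>x / 0 = 0\<close>, this is only the intended sequence as long as no term
  vanishes; below it is used over a field of rational functions, where all terms are non-zero.
\<close>

fun somos4_fwd :: "'f::field \<Rightarrow> 'f \<Rightarrow> 'f \<Rightarrow> 'f \<Rightarrow> 'f \<Rightarrow> 'f \<Rightarrow> nat \<Rightarrow> 'f" where
  "somos4_fwd a b s0 s1 s2 s3 0 = s0"
| "somos4_fwd a b s0 s1 s2 s3 (Suc 0) = s1"
| "somos4_fwd a b s0 s1 s2 s3 (Suc (Suc 0)) = s2"
| "somos4_fwd a b s0 s1 s2 s3 (Suc (Suc (Suc 0))) = s3"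
| "somos4_fwd a b s0 s1 s2 s3 (Suc (Suc (Suc (Suc n)))) =
     (a * somos4_fwd a b s0 s1 s2 s3 (Suc (Suc (Suc n))) * somos4_fwd a b s0 s1 s2 s3 (Suc n)
      + b * (somos4_fwd a b s0 s1 s2 s3 (Suc (Suc n)))\<^sup>2)
     / somos4_fwd a b s0 s1 s2 s3 n"

text \<open>
  The recurrence is invariant under reversing the order of the terms, so iterating it backwards
  from the terms of index 4, 3, 2, 1 is the same as iterating it forwards from the reversed data.
\<close>

definition somos4_iter :: "'f::field \<Rightarrow> 'f \<Rightarrow> 'f \<Rightarrow> 'f \<Rightarrow> 'f \<Rightarrow> 'f \<Rightarrow> int \<Rightarrow> 'f" where
  "somos4_iter a b x1 x2 x3 x4 n =
     (if n \<ge> 1 then somos4_fwd a b x1 x2 x3 x4 (nat (n - 1))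
      else somos4_fwd a b x4 x3 x2 x1 (nat (4 - n)))"

text \<open>
  Integer polynomials in six indeterminates, as an iterated polynomial ring: the innermost
  indeterminate is \<open>\<alpha>\<close>, followed by \<open>\<beta>\<close>, \<open>A\<^sub>1\<close>, \<open>A\<^sub>2\<close>, \<open>A\<^sub>3\<close> and, outermost, \<open>A\<^sub>4\<close>.
\<close>

type_synonym pol6 = "int poly poly poly poly poly poly"

definition var_alpha :: pol6 where "var_alpha = [:[:[:[:[:[:0, 1:]:]:]:]:]:]"
definition var_beta :: pol6 where "var_beta = [:[:[:[:[:0, 1:]:]:]:]:]"
definition var_A1 :: pol6 where "var_A1 = [:[:[:[:0, 1:]:]:]:]"
definition var_A2 :: pol6 where "var_A2 = [:[:[:0, 1:]:]:]"
definition var_A3 :: pol6 where "var_A3 = [:[:0, 1:]:]"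
definition var_A4 :: pol6 where "var_A4 = [:0, 1:]"

definition somos4_formal :: "int \<Rightarrow> pol6 fract" where
  "somos4_formal =
     somos4_iter (to_fract var_alpha) (to_fract var_beta)
       (to_fract var_A1) (to_fract var_A2) (to_fract var_A3) (to_fract var_A4)"

definition eval_ext :: "('r::zero \<Rightarrow> 'a) \<Rightarrow> 'a \<Rightarrow> 'r poly \<Rightarrow> 'a::comm_ring_1" where
  "eval_ext h x p = poly (map_poly h p) x"

definition eval6 :: "'a::comm_ring_1 \<Rightarrow> 'a \<Rightarrow> 'a \<Rightarrow> 'a \<Rightarrow> 'a \<Rightarrow> 'a \<Rightarrow> pol6 \<Rightarrow> 'a" where
  "eval6 a b x1 x2 x3 x4 =
     eval_ext (eval_ext (eval_ext (eval_ext (eval_ext (eval_ext of_int a) b) x1) x2) x3) x4"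

text \<open>
  The value of a rational function at a point: \<open>P/Q\<close> for any representation as a fraction whose
  denominator does not vanish there. It does not depend on the representation
  (\<open>ratfun_value_eq\<close>), and is unspecified where there is no such representation.
\<close>

definition ratfun_value :: "'a::field \<Rightarrow> 'a \<Rightarrow> 'a \<Rightarrow> 'a \<Rightarrow> 'a \<Rightarrow> 'a \<Rightarrow> pol6 fract \<Rightarrow> 'a" where
  "ratfun_value a b x1 x2 x3 x4 f =
     (THE v. \<exists>P Q. f = to_fract P / to_fract Q \<and> eval6 a b x1 x2 x3 x4 Q \<noteq> 0 \<and>
        v = eval6 a b x1 x2 x3 x4 P / eval6 a b x1 x2 x3 x4 Q)"

text \<open>
  The Somos 4 sequence with coefficients \<open>a\<close>, \<open>b\<close> and initial data \<open>x1, ..., x4\<close> at the indices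
  1, ..., 4, continued analytically through zero terms.
\<close>

definition somos4 :: "'a::field \<Rightarrow> 'a \<Rightarrow> 'a \<Rightarrow> 'a \<Rightarrow> 'a \<Rightarrow> 'a \<Rightarrow> int \<Rightarrow> 'a" where
  "somos4 a b x1 x2 x3 x4 n = ratfun_value a b x1 x2 x3 x4 (somos4_formal n)"


subsection \<open>Evaluation is a ring homomorphism\<close>

definition is_ring_hom :: "('r::comm_ring_1 \<Rightarrow> 'a::comm_ring_1) \<Rightarrow> bool" where
  "is_ring_hom h \<longleftrightarrow> h 0 = 0 \<and> h 1 = 1 \<and> (\<forall>x y. h (x + y) = h x + h y) \<and> (\<forall>x y. h (x * y) = h x * h y)"

lemma eval_ext_pCons:
  assumes "h 0 = 0"
  shows "eval_ext h x (pCons c p) = h c + x * eval_ext h x p"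
  using assms by (simp add: eval_ext_def map_poly_pCons)

lemma is_ring_hom_eval_ext:
  assumes "is_ring_hom h"
  shows "is_ring_hom (eval_ext h x)"
proof -
  have h: "h 0 = 0" "h 1 = 1" "\<And>x y. h (x + y) = h x + h y" "\<And>x y. h (x * y) = h x * h y"
    using assms by (auto simp: is_ring_hom_def)
  have e0: "eval_ext h x 0 = 0" by (simp add: eval_ext_def)
  have e1: "eval_ext h x 1 = 1" using h by (simp add: eval_ext_def)
  have add: "eval_ext h x (p + q) = eval_ext h x p + eval_ext h x q" for p q
    by (induction p q rule: poly_induct2) (simp_all add: e0 eval_ext_pCons h algebra_simps)
  have smult: "eval_ext h x (smult c p) = h c * eval_ext h x p" for c p
    by (induction p) (simp_all add: e0 eval_ext_pCons h algebra_simps)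
  have mult: "eval_ext h x (p * q) = eval_ext h x p * eval_ext h x q" for p q
    by (induction p) (simp_all add: e0 eval_ext_pCons h add smult algebra_simps)
  show ?thesis using e0 e1 add mult by (simp add: is_ring_hom_def)
qed

lemma is_ring_hom_eval6: "is_ring_hom (eval6 a b x1 x2 x3 x4)"
proof -
  have "is_ring_hom (of_int :: int \<Rightarrow> 'a::comm_ring_1)" by (simp add: is_ring_hom_def)
  thus ?thesis unfolding eval6_def by (intro is_ring_hom_eval_ext)
qed

lemma eval6_hom [simp]:
  "eval6 a b x1 x2 x3 x4 0 = 0"
  "eval6 a b x1 x2 x3 x4 1 = 1"
  "eval6 a b x1 x2 x3 x4 (P + Q) = eval6 a b x1 x2 x3 x4 P + eval6 a b x1 x2 x3 x4 Q"
  "eval6 a b x1 x2 x3 x4 (P * Q) = eval6 a b x1 x2 x3 x4 P * eval6 a b x1 x2 x3 x4 Q"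
  using is_ring_hom_eval6[of a b x1 x2 x3 x4] by (simp_all add: is_ring_hom_def)

lemma eval6_var [simp]:
  "eval6 a b x1 x2 x3 x4 var_alpha = a"
  "eval6 a b x1 x2 x3 x4 var_beta = b"
  "eval6 a b x1 x2 x3 x4 var_A1 = x1"
  "eval6 a b x1 x2 x3 x4 var_A2 = x2"
  "eval6 a b x1 x2 x3 x4 var_A3 = x3"
  "eval6 a b x1 x2 x3 x4 var_A4 = x4"
  by (simp_all add: eval6_def eval_ext_def map_poly_pCons var_alpha_def var_beta_def var_A1_def
      var_A2_def var_A3_def var_A4_def)

lemma ratfun_value_eq:
  assumes "eval6 a b x1 x2 x3 x4 Q \<noteq> 0"
  shows "ratfun_value a b x1 x2 x3 x4 (to_fract P / to_fract Q) =
           eval6 a b x1 x2 x3 x4 P / eval6 a b x1 x2 x3 x4 Q"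
  unfolding ratfun_value_def
proof (rule the_equality)
  let ?e = "eval6 a b x1 x2 x3 x4"
  show "\<exists>P' Q'. to_fract P / to_fract Q = to_fract P' / to_fract Q' \<and> ?e Q' \<noteq> 0 \<and>
          ?e P / ?e Q = ?e P' / ?e Q'"
    using assms by blast
  fix v
  assume "\<exists>P' Q'. to_fract P / to_fract Q = to_fract P' / to_fract Q' \<and> ?e Q' \<noteq> 0 \<and> v = ?e P' / ?e Q'"
  then obtain P' Q' where *: "to_fract P / to_fract Q = to_fract P' / to_fract Q'"
    "?e Q' \<noteq> 0" "v = ?e P' / ?e Q'" by blast
  have "Q \<noteq> 0" "Q' \<noteq> 0" using assms *(2) by auto
  hence "to_fract P * to_fract Q' = to_fract P' * to_fract Q"
    using *(1) by (simp add: field_simps)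
  hence "to_fract (P * Q') = to_fract (P' * Q)" by simp
  hence "P * Q' = P' * Q" by (simp only: to_fract_eq_iff)
  hence "?e P * ?e Q' = ?e P' * ?e Q" by (metis eval6_hom(4))
  thus "v = ?e P / ?e Q" using assms *(2,3) by (simp add: frac_eq_eq)
qed


subsection \<open>The formal sequence\<close>

lemma somos4_fwd_pos:
  fixes a :: "'f::linordered_field"
  assumes "a > 0" "b > 0" "s0 > 0" "s1 > 0" "s2 > 0" "s3 > 0"
  shows "somos4_fwd a b s0 s1 s2 s3 n > 0"
  using assms
  by (induction a b s0 s1 s2 s3 n rule: somos4_fwd.induct) (simp_all add: add_pos_pos)

text \<open>
  Positivity refers to the ordering of polynomials by the sign of the leading coefficient.
\<close>

lemma vars_pos:
  "to_fract var_alpha > 0" "to_fract var_beta > 0" "to_fract var_A1 > 0"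
  "to_fract var_A2 > 0" "to_fract var_A3 > 0" "to_fract var_A4 > 0"
proof -
  have pCons: "0 < pCons c p \<longleftrightarrow> 0 < p \<or> (p = 0 \<and> 0 < c)"
    for c :: "'r::linordered_idom" and p
    by (simp add: less_poly_def pos_poly_pCons)
  have to_fract: "0 < to_fract p \<longleftrightarrow> 0 < p" for p :: "'r::linordered_idom"
    by (simp add: to_fract_def Fraction_Field.zero_less_Fract_iff)
  show "to_fract var_alpha > 0" "to_fract var_beta > 0" "to_fract var_A1 > 0"
    "to_fract var_A2 > 0" "to_fract var_A3 > 0" "to_fract var_A4 > 0"
    by (simp_all add: to_fract pCons var_alpha_def var_beta_def var_A1_def var_A2_def
        var_A3_def var_A4_def)
qed

lemma somos4_formal_nonzero: "somos4_formal n \<noteq> 0"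
  unfolding somos4_formal_def somos4_iter_def
  using vars_pos somos4_fwd_pos by (smt (verit) less_irrefl)

lemma somos4_formal_init:
  "somos4_formal 1 = to_fract var_A1" "somos4_formal 2 = to_fract var_A2"
  "somos4_formal 3 = to_fract var_A3" "somos4_formal 4 = to_fract var_A4"
  by (simp_all add: somos4_formal_def somos4_iter_def numeral_2_eq_2 numeral_3_eq_3)

lemma somos4_formal_rec:
  "somos4_formal (n + 4) * somos4_formal n =
     to_fract var_alpha * somos4_formal (n + 3) * somos4_formal (n + 1)
     + to_fract var_beta * (somos4_formal (n + 2))\<^sup>2"
proof (cases "n \<ge> 1")
  case True
  define k where "k = nat (n - 1)"
  have "nat (n + 4 - 1) = Suc (Suc (Suc (Suc k)))" "nat (n + 3 - 1) = Suc (Suc (Suc k))"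
    "nat (n + 2 - 1) = Suc (Suc k)" "nat (n + 1 - 1) = Suc k"
    using True by (auto simp: k_def)
  thus ?thesis
    using True somos4_formal_nonzero[of n] unfolding somos4_formal_def somos4_iter_def
    by (simp add: k_def)
next
  case False
  define k where "k = nat (- n)"
  let ?B = "somos4_fwd (to_fract var_alpha) (to_fract var_beta)
       (to_fract var_A4) (to_fract var_A3) (to_fract var_A2) (to_fract var_A1)"
  have neg: "somos4_formal m = ?B (nat (4 - m))" if "m \<le> 4" for m
  proof (cases "m \<ge> 1")
    case True
    hence "m = 1 \<or> m = 2 \<or> m = 3 \<or> m = 4" using that by auto
    thus ?thesis by (auto simp: somos4_formal_init numeral_2_eq_2 numeral_3_eq_3)
  qed (simp add: somos4_formal_def somos4_iter_def)
  have "nat (4 - n) = Suc (Suc (Suc (Suc k)))" "nat (4 - (n + 1)) = Suc (Suc (Suc k))"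
    "nat (4 - (n + 2)) = Suc (Suc k)" "nat (4 - (n + 3)) = Suc k" "nat (4 - (n + 4)) = k"
    using False by (auto simp: k_def)
  hence B: "somos4_formal n = ?B (Suc (Suc (Suc (Suc k))))"
    "somos4_formal (n + 1) = ?B (Suc (Suc (Suc k)))" "somos4_formal (n + 2) = ?B (Suc (Suc k))"
    "somos4_formal (n + 3) = ?B (Suc k)" "somos4_formal (n + 4) = ?B k"
    using neg[of n] neg[of "n + 1"] neg[of "n + 2"] neg[of "n + 3"] neg[of "n + 4"] False by simp_all
  have "?B k \<noteq> 0" using somos4_formal_nonzero[of "n + 4"] B by simp
  thus ?thesis unfolding B by (simp add: mult_ac)
qed

lemma somos4_init:
  "somos4 a b x1 x2 x3 x4 1 = x1" "somos4 a b x1 x2 x3 x4 2 = x2"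
  "somos4 a b x1 x2 x3 x4 3 = x3" "somos4 a b x1 x2 x3 x4 4 = x4"
  using ratfun_value_eq[of a b x1 x2 x3 x4 1 var_A1] ratfun_value_eq[of a b x1 x2 x3 x4 1 var_A2]
    ratfun_value_eq[of a b x1 x2 x3 x4 1 var_A3] ratfun_value_eq[of a b x1 x2 x3 x4 1 var_A4]
  by (simp_all add: somos4_def somos4_formal_init)

end

theory Submission
  imports Defs
begin

text \<open>
  A Somos 4 sequence \<open>A\<close> has a conserved quantity \<open>T\<close>; put \<open>I = \<alpha>\<^sup>2 + \<beta> T\<close>. It also has a companion
  elliptic divisibility sequence \<open>W\<close> with \<open>W\<^sub>0 = 0\<close>, \<open>W\<^sub>1 = 1\<close>, \<open>W\<^sub>2 = sqrt \<alpha>\<close>, \<open>W\<^sub>3 = - \<beta>\<close>,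
  \<open>W\<^sub>4 = - I W\<^sub>2\<close>, which satisfies the same recurrence with the same \<open>T\<close>, and the two are linked by
  \[ A_{n+m} A_{n-m} = W_m^2 A_{n+1} A_{n-1} - W_{m+1} W_{m-1} A_n^2, \]
  \[ W_2 A_{n+m+1} A_{n-m} = W_{m+1} W_m A_{n+2} A_{n-1} - W_{m+2} W_{m-1} A_{n+1} A_n \]
  (\<open>elliptic_identities\<close>). On the elliptic curve behind the recurrence these are addition formulas;
  here they are proved by a joint induction on \<open>m\<close>, because the product of two consecutive left-hand
  sides of one kind is a product of two left-hand sides of the other kind, and the corresponding
  products of right-hand sides agree modulo the recurrence and the conservation of \<open>T\<close>.

  Applied to \<open>W\<close> itself, the identities with \<open>n = m + 1\<close> are doubling formulas, which
  express \<open>W\<close> through integer polynomials in \<open>\<alpha>\<close>, \<open>\<beta>\<close>, \<open>I\<close> (\<open>companion_in_subring\<close>). Applied to \<open>A\<close>,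
  they give \<open>A\<^sub>n A\<^sub>1\<close> in terms of earlier terms, hence the strong Laurent property: for \<open>n \<ge> 1\<close>, \<open>A\<^sub>n\<close> is
  an integer polynomial in \<open>\<alpha>\<close>, \<open>\<beta>\<close>, \<open>I\<close>, \<open>A\<^sub>1\<close>, ..., \<open>A\<^sub>4\<close> and \<open>1/A\<^sub>1\<close> only (\<open>terms_in_subring\<close>). All this
  takes place in the field of rational functions, where no term of either sequence vanishes.

  Now fix a prime \<open>p\<close>. As \<open>gcd(A\<^sub>1, A\<^sub>2) = 1\<close>, some \<open>j \<in> {1, 2}\<close> has \<open>A\<^sub>j\<close> prime to \<open>p\<close>. Both
  the strong Laurent property started at \<open>A\<^sub>j\<close> and going right and its mirror image
  going left involve only terms among the eight given integers, \<open>1/A\<^sub>j\<close> and the value of \<open>I\<close>. So all terms are \<open>p\<close>-integral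
  once \<open>I\<close> is, and the gcd conditions involving \<open>\<alpha>\<close> give exactly this (\<open>invariant_p_integral\<close>).
  A rational number that is \<open>p\<close>-integral for all \<open>p\<close> is an integer.
\<close>

section \<open>Subrings\<close>

definition subring_set :: "'r::comm_ring_1 set \<Rightarrow> bool" where
  "subring_set S \<longleftrightarrow> 1 \<in> S \<and> (\<forall>x\<in>S. \<forall>y\<in>S. x - y \<in> S \<and> x * y \<in> S)"

lemma subring_setD:
  assumes "subring_set S"
  shows "0 \<in> S" "1 \<in> S" "x \<in> S \<Longrightarrow> y \<in> S \<Longrightarrow> x - y \<in> S" "x \<in> S \<Longrightarrow> y \<in> S \<Longrightarrow> x * y \<in> S"
    "x \<in> S \<Longrightarrow> - x \<in> S" "x \<in> S \<Longrightarrow> y \<in> S \<Longrightarrow> x + y \<in> S" "x \<in> S \<Longrightarrow> x ^ n \<in> S"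
proof -
  show diff: "x - y \<in> S" and mult: "x * y \<in> S" if "x \<in> S" "y \<in> S" for x y
    using assms that by (auto simp: subring_set_def)
  show one: "1 \<in> S" using assms by (simp add: subring_set_def)
  show zero: "0 \<in> S" using diff[OF one one] by simp
  show neg: "- x \<in> S" if "x \<in> S" for x using diff[OF zero that] by simp
  show "x + y \<in> S" if "x \<in> S" "y \<in> S" using diff[OF that(1) neg[OF that(2)]] by simp
  show "x ^ n \<in> S" if "x \<in> S" by (induction n) (auto simp: one mult that)
qed

section \<open>Weighted Somos 4 sequences and their conserved quantity\<close>

text \<open>
  The sequence \<open>sqrt (d n) * A n\<close> satisfies the Somos 4 recurrence, and this is written without the
  square root. Constant weights 1 give ordinary Somos 4 sequences; the weights \<open>\<alpha>, 1, \<alpha>, 1, ...\<close> allow the companion sequence, whose terms of even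
  index are multiples of \<open>sqrt \<alpha>\<close>, to be handled over the same field. The term of index 0
  may vanish, as it does for the companion sequence.
\<close>
definition weighted_somos4 ::
    "'f::field \<Rightarrow> 'f \<Rightarrow> (nat \<Rightarrow> 'f) \<Rightarrow> (nat \<Rightarrow> 'f) \<Rightarrow> bool" where
  "weighted_somos4 \<alpha> \<beta> d A \<longleftrightarrow>
     (\<forall>n. d n \<noteq> 0 \<and> d (n + 2) = d n) \<and> (\<forall>n\<ge>1. A n \<noteq> 0) \<and>
     (\<forall>n. d n * A (n + 4) * A n =
        \<alpha> * d (n + 1) * A (n + 3) * A (n + 1) + \<beta> * d n * A (n + 2) ^ 2)"

text \<open>
  With \<open>f n = A (n + 1) * A (n - 1) / A n ^ 2\<close> the recurrence reads
  \<open>f (n - 1) * f n ^ 2 * f (n + 1) = \<alpha> * f n + \<beta>\<close>, and it conserves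
  \<open>T = f n * f (n + 1) + \<alpha> * (1 / f n + 1 / f (n + 1)) + \<beta> / (f n * f (n + 1))\<close>, which is equal to
  \<open>f n * f (n + 1) + f n * f (n - 1) + \<alpha> / f n\<close>. The following predicates are the second and the
  first of these expressions for \<open>T\<close>, with denominators cleared and weights inserted.
\<close>
definition cubic_integral where
  "cubic_integral \<alpha> T d A n \<longleftrightarrow>
     d (n + 1) * A (n + 4) * A (n + 1) ^ 2 + d (n + 1) * A (n + 3) ^ 2 * A n + \<alpha> * d n * A (n + 2) ^ 3
     = (T::'f::field) * d (n + 1) * A (n + 1) * A (n + 2) * A (n + (3::nat))"

definition quartic_integral where
  "quartic_integral \<alpha> \<beta> T d A n \<longleftrightarrow>
     d n * d (n + 1) * A n ^ 2 * A (n + 3) ^ 2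
     + \<alpha> * (d (n + 1) ^ 2 * A (n + 1) ^ 3 * A (n + 3) + d n ^ 2 * A n * A (n + 2) ^ 3)
     + \<beta> * d n * d (n + 1) * A (n + 1) ^ 2 * A (n + 2) ^ 2
     = (T::'f::field) * d n * d (n + 1) * A n * A (n + 1) * A (n + 2) * A (n + (3::nat))"

lemma cubic_imp_quartic:
  assumes "weighted_somos4 \<alpha> \<beta> d A" and "cubic_integral \<alpha> T d A n"
  shows "quartic_integral \<alpha> \<beta> T d A (Suc n)"
proof -
  have d: "d (Suc (Suc n)) = d n"
    using assms(1) by (auto simp: weighted_somos4_def)
  have S: "d n * A (n + 4) * A n = \<alpha> * d (n + 1) * A (n + 3) * A (n + 1) + \<beta> * d n * A (n + 2) ^ 2"
    using assms(1) by (auto simp: weighted_somos4_def)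
  have C: "d (n + 1) * A (n + 4) * A (n + 1) ^ 2 + d (n + 1) * A (n + 3) ^ 2 * A n + \<alpha> * d n * A (n + 2) ^ 3
     = T * d (n + 1) * A (n + 1) * A (n + 2) * A (n + 3)"
    using assms(2) by (simp add: cubic_integral_def)
  define u v w x y p q where "u = A n" "v = A (n+1)" "w = A (n+2)" "x = A (n+3)" "y = A (n+4)"
    "p = d n" "q = d (n+1)"
  note defs = this
  have "q * p * v^2 * y^2 + \<alpha> * (p^2 * w^3 * y + q^2 * v * x^3) + \<beta> * q * p * w^2 * x^2
     = T * q * p * v * w * x * y"
    using S C unfolding defs[symmetric] by algebra
  thus ?thesis using d unfolding quartic_integral_def by (simp add: defs eval_nat_numeral)
qed

lemma quartic_imp_cubic:
  assumes "weighted_somos4 \<alpha> \<beta> d A" and "quartic_integral \<alpha> \<beta> T d A n" and "A n \<noteq> 0"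
  shows "cubic_integral \<alpha> T d A n"
proof -
  have S: "d n * A (n + 4) * A n = \<alpha> * d (n + 1) * A (n + 3) * A (n + 1) + \<beta> * d n * A (n + 2) ^ 2"
    and dn: "d n \<noteq> 0"
    using assms(1) by (auto simp: weighted_somos4_def)
  define u v w x y p q where "u = A n" "v = A (n+1)" "w = A (n+2)" "x = A (n+3)" "y = A (n+4)"
    "p = d n" "q = d (n+1)"
  note defs = this
  have "(p * u) * (q * y * v^2 + q * x^2 * u + \<alpha> * p * w^3) = (p * u) * (T * q * v * w * x)"
    using S assms(2) unfolding quartic_integral_def defs[symmetric] by algebra
  moreover have "p * u \<noteq> 0" using dn assms(3) by (simp add: defs)
  ultimately show ?thesis unfolding cubic_integral_def by (simp add: defs)
qed

lemma integrals_conserved: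
  assumes W: "weighted_somos4 \<alpha> \<beta> d A"
    and "cubic_integral \<alpha> T d A 0" "quartic_integral \<alpha> \<beta> T d A 0"
  shows "cubic_integral \<alpha> T d A n" "quartic_integral \<alpha> \<beta> T d A n"
proof -
  have C: "cubic_integral \<alpha> T d A n" for n
  proof (induction n)
    case (Suc n)
    show ?case
      by (rule quartic_imp_cubic[OF W cubic_imp_quartic[OF W Suc]])
        (use W in \<open>auto simp: weighted_somos4_def\<close>)
  qed (fact assms)
  thus "cubic_integral \<alpha> T d A n" .
  show "quartic_integral \<alpha> \<beta> T d A n"
    by (cases n) (use assms C cubic_imp_quartic[OF W] in auto)
qed

section \<open>The companion elliptic divisibility sequence\<close>

text \<open>
  This is \<open>V m = W m\<close> for odd \<open>m\<close> and \<open>V m = W m / sqrt \<alpha>\<close> for even \<open>m\<close>, where \<open>W\<close> is the elliptic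
  divisibility sequence described at the top. The factor \<open>\<alpha>\<^sup>2\<close> results from this normalisation.
  The value at 4 has to be prescribed, as the recurrence for it would divide by \<open>V 0 = 0\<close>; it is
  the one for which the conserved quantity of \<open>W\<close> is \<open>T\<close>.
\<close>
fun companion :: "'f::field \<Rightarrow> 'f \<Rightarrow> 'f \<Rightarrow> nat \<Rightarrow> 'f" where
  "companion \<alpha> \<beta> T 0 = 0"
| "companion \<alpha> \<beta> T (Suc 0) = 1"
| "companion \<alpha> \<beta> T (Suc (Suc 0)) = 1"
| "companion \<alpha> \<beta> T (Suc (Suc (Suc 0))) = - \<beta>"
| "companion \<alpha> \<beta> T (Suc (Suc (Suc (Suc 0)))) = - (\<alpha>\<^sup>2 + \<beta> * T)"
| "companion \<alpha> \<beta> T (Suc (Suc (Suc (Suc (Suc n))))) =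
     ((if even n then \<alpha>\<^sup>2 else 1) * companion \<alpha> \<beta> T (Suc (Suc (Suc (Suc n)))) * companion \<alpha> \<beta> T (Suc (Suc n))
       + \<beta> * (companion \<alpha> \<beta> T (Suc (Suc (Suc n))))\<^sup>2) / companion \<alpha> \<beta> T (Suc n)"

text \<open>The square of \<open>W m\<close> is \<open>parity_weight \<alpha> m * V m ^ 2\<close>.\<close>
definition parity_weight :: "'f::field \<Rightarrow> nat \<Rightarrow> 'f" where
  "parity_weight \<alpha> n = (if even n then \<alpha> else 1)"

lemma companion_weighted_somos4:
  assumes "\<alpha> \<noteq> 0" and nz: "\<And>n. n \<ge> 1 \<Longrightarrow> companion \<alpha> \<beta> T n \<noteq> 0"
  shows "weighted_somos4 \<alpha> \<beta> (parity_weight \<alpha>) (companion \<alpha> \<beta> T)"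
  unfolding weighted_somos4_def
proof (intro conjI allI impI)
  fix n :: nat
  let ?d = "parity_weight \<alpha>" and ?V = "companion \<alpha> \<beta> T"
  show "?d n * ?V (n + 4) * ?V n = \<alpha> * ?d (n + 1) * ?V (n + 3) * ?V (n + 1) + \<beta> * ?d n * ?V (n + 2) ^ 2"
  proof (cases n)
    case 0
    thus ?thesis by (simp add: parity_weight_def numeral_2_eq_2 numeral_3_eq_3)
  next
    case (Suc m)
    have "?V (Suc m) \<noteq> 0" using nz by simp
    hence *: "?V (n + 4) * ?V n =
        (if even m then \<alpha>\<^sup>2 else 1) * ?V (n + 3) * ?V (n + 1) + \<beta> * ?V (n + 2) ^ 2"
      by (simp add: Suc eval_nat_numeral)
    show ?thesis
    proof (cases "even m")
      case True
      thus ?thesis using * by (simp add: Suc parity_weight_def power2_eq_square)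
    next
      case False
      have "\<alpha> * (?V (n + 4) * ?V n) = \<alpha> * (?V (n + 3) * ?V (n + 1) + \<beta> * ?V (n + 2) ^ 2)"
        using * False by simp
      thus ?thesis using False by (simp add: Suc parity_weight_def algebra_simps)
    qed
  qed
qed (use assms in \<open>auto simp: parity_weight_def\<close>)

lemma companion_integrals:
  assumes "\<alpha> \<noteq> 0" and nz: "\<And>n. n \<ge> 1 \<Longrightarrow> companion \<alpha> \<beta> T n \<noteq> 0"
  shows "cubic_integral \<alpha> T (parity_weight \<alpha>) (companion \<alpha> \<beta> T) n"
    and "quartic_integral \<alpha> \<beta> T (parity_weight \<alpha>) (companion \<alpha> \<beta> T) n"
proof -
  note W = companion_weighted_somos4[OF assms]
  have C: "cubic_integral \<alpha> T (parity_weight \<alpha>) (companion \<alpha> \<beta> T) 0"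
    by (simp add: cubic_integral_def parity_weight_def eval_nat_numeral algebra_simps)
  have Q: "quartic_integral \<alpha> \<beta> T (parity_weight \<alpha>) (companion \<alpha> \<beta> T) 0"
    by (simp add: quartic_integral_def parity_weight_def eval_nat_numeral algebra_simps)
  show "cubic_integral \<alpha> T (parity_weight \<alpha>) (companion \<alpha> \<beta> T) n"
    by (rule integrals_conserved(1)[OF W C Q])
  show "quartic_integral \<alpha> \<beta> T (parity_weight \<alpha>) (companion \<alpha> \<beta> T) n"
    by (rule integrals_conserved(2)[OF W C Q])
qed

section \<open>The addition identities\<close>

lemma weight_product:
  assumes "weighted_somos4 \<alpha> \<beta> d A"
  shows "d n * d (Suc n) = d 0 * d 1"
proof (induction n)
  case (Suc n)
  have "d (Suc (Suc n)) = d n" using assms by (auto simp: weighted_somos4_def)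
  thus ?case using Suc by (simp add: mult.commute)
qed simp

text \<open>
  The algebraic core of the passage from \<open>m\<close> to \<open>m + 1\<close> in the even identity. Here
  \<open>a, b, c, e, f\<close> are five consecutive terms of \<open>A\<close> and \<open>u, v, w, t\<close> are four consecutive terms of the
  companion sequence from index \<open>m - 1\<close> on. After \<open>a\<close> and \<open>f\<close> have been eliminated by the recurrence and
  the cubic integral of \<open>A\<close>, the coefficients of \<open>e\<^sup>2 b\<^sup>2\<close> and \<open>c\<^sup>4\<close> agree; comparing those of \<open>e b c\<^sup>2\<close> gives
  the quartic integral of the companion sequence.
\<close>
lemma even_step:
  fixes \<alpha> :: "'f::field"
  assumes "p * f * a = \<alpha> * q * e * b + \<beta> * p * c^2"
    and "q * f * b^2 + q * e^2 * a + \<alpha> * p * c^3 = T * q * b * c * e"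
    and "s * r * u^2 * t^2 + \<alpha> * (r^2 * v^3 * t + s^2 * u * w^3) + \<beta> * s * r * v^2 * w^2
         = T * s * r * u * v * w * t"
    and "s * r = \<alpha>" "\<alpha> \<noteq> 0"
  shows "(s * w^2 * q * e * b - r * t * v * p * c^2) * (r * v^2 * q * e * b - s * w * u * p * c^2)
       = p * q * ((w * v * f * b - t * u * e * c) * (w * v * e * a - t * u * c * b))"
proof -
  have "\<alpha> * (u^2 * t^2 + (r^2 * v^3 * t + s^2 * u * w^3) + \<beta> * v^2 * w^2) = \<alpha> * (T * u * v * w * t)"
    using assms(3,4) by algebra
  hence "u^2 * t^2 + (r^2 * v^3 * t + s^2 * u * w^3) + \<beta> * v^2 * w^2 = T * u * v * w * t"
    using assms(5) by simp
  thus ?thesis using assms(1,2,4) by algebra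
qed

text \<open>
  The algebraic core of the passage from \<open>m\<close> to \<open>m + 1\<close> in the odd identity. Here \<open>b, c, e, f\<close> are
  four consecutive terms of \<open>A\<close> and \<open>y, u, v, w, t\<close> are five consecutive terms of the companion
  sequence from index \<open>m - 1\<close> on. Both sides are quadratic in \<open>b f / (c e)\<close> after the quartic integral of \<open>A\<close>
  has been used; the recurrence and the cubic integral of the companion sequence match the
  constant and the linear coefficient.
\<close>
lemma odd_step:
  fixes \<alpha> :: "'f::field"
  assumes "q * p * b^2 * f^2 + \<alpha> * (p^2 * c^3 * f + q^2 * b * e^3) + \<beta> * q * p * c^2 * e^2
         = T * q * p * b * c * e * f"
    and "r * t * y = \<alpha> * s * w * u + \<beta> * r * v^2"
    and "s * t * u^2 + s * w^2 * y + \<alpha> * r * v^3 = T * s * u * v * w"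
    and "r * s = \<alpha>" "\<alpha> \<noteq> 0"
  shows "(r * v^2 * q * e * b - s * w * u * p * c^2) * (r * v^2 * p * f * c - s * w * u * q * e^2)
       = p * q * ((w * v * f * b - t * u * e * c) * (v * u * f * b - w * y * e * c))"
proof -
  \<comment> \<open>The recurrence and the cubic integral of the companion sequence carry the factors \<open>r\<close> and \<open>s\<close>.\<close>
  have "r * s * ((r * v^2 * q * e * b - s * w * u * p * c^2) * (r * v^2 * p * f * c - s * w * u * q * e^2))
       = r * s * (p * q * ((w * v * f * b - t * u * e * c) * (v * u * f * b - w * y * e * c)))"
    using assms(1-4) by algebra
  thus ?thesis using assms(4,5) by simp
qed


text \<open>
  In terms of \<open>W\<close> the first coefficient is \<open>W\<^sub>m\<^sup>2\<close> and the second one \<open>W\<^sub>m\<^sub>+\<^sub>1 W\<^sub>m\<^sub>-\<^sub>1\<close>. In the odd identity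
  the factors \<open>sqrt \<alpha>\<close> cancel against \<open>W\<^sub>2\<close>, since exactly one index in each coefficient is even.
\<close>
definition even_identity where
  "even_identity (\<alpha>::'f::field) \<beta> T d A m n \<longleftrightarrow>
     d (n + m) * A (n + m) * A (n - m) =
       parity_weight \<alpha> m * companion \<alpha> \<beta> T m ^ 2 * d (n + 1) * A (n + 1) * A (n - 1)
       - parity_weight \<alpha> (m + 1) * companion \<alpha> \<beta> T (m + 1) * companion \<alpha> \<beta> T (m - 1)
         * d n * A n ^ 2"

definition odd_identity where
  "odd_identity (\<alpha>::'f::field) \<beta> T A m n \<longleftrightarrow>
     A (n + m + 1) * A (n - m) =
       companion \<alpha> \<beta> T (m + 1) * companion \<alpha> \<beta> T m * A (n + 2) * A (n - 1)
       - companion \<alpha> \<beta> T (m + 2) * companion \<alpha> \<beta> T (m - 1) * A (n + 1) * A n"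

context
  fixes \<alpha> \<beta> T :: "'f::field" and d A :: "nat \<Rightarrow> 'f"
  assumes alpha_nz: "\<alpha> \<noteq> 0" and companion_nz: "\<And>n. n \<ge> 1 \<Longrightarrow> companion \<alpha> \<beta> T n \<noteq> 0"
    and somos: "weighted_somos4 \<alpha> \<beta> d A"
    and cubic: "\<And>n. cubic_integral \<alpha> T d A n" and quartic: "\<And>n. quartic_integral \<alpha> \<beta> T d A n"
begin

private abbreviation (input) "V \<equiv> companion \<alpha> \<beta> T"
private abbreviation (input) "c \<equiv> parity_weight \<alpha>"

lemma weights: "d n \<noteq> 0" "d (n + 2) = d n" "d n * d (n + 1) = d k * d (k + 1)"
  using somos by (simp_all add: weighted_somos4_def) (metis weight_product[OF somos])

lemma terms_nz: "n \<ge> 1 \<Longrightarrow> A n \<noteq> 0"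
  using somos by (auto simp: weighted_somos4_def)

lemma parity_weights: "c (n + 2) = c n" "c n * c (n + 1) = \<alpha>"
  by (auto simp: parity_weight_def)

text \<open>
  The product of \<open>A\<^sub>n\<^sub>+\<^sub>m\<^sub>+\<^sub>1 A\<^sub>n\<^sub>-\<^sub>m\<^sub>-\<^sub>1\<close> and \<open>A\<^sub>n\<^sub>+\<^sub>m A\<^sub>n\<^sub>-\<^sub>m\<close> is also the product of
  \<open>A\<^sub>n\<^sub>+\<^sub>m\<^sub>+\<^sub>1 A\<^sub>n\<^sub>-\<^sub>m\<close> and \<open>A\<^sub>n\<^sub>+\<^sub>m A\<^sub>n\<^sub>-\<^sub>m\<^sub>-\<^sub>1\<close>, to which the odd identities at \<open>n\<close> and \<open>n - 1\<close> apply; the factor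
  known from the even identity can then be cancelled.
\<close>
lemma even_identity_Suc:
  assumes n: "n > Suc m" and m: "m \<ge> 1"
    and E: "even_identity \<alpha> \<beta> T d A m n"
    and O: "odd_identity \<alpha> \<beta> T A m n" "odd_identity \<alpha> \<beta> T A m (n - 1)"
  shows "even_identity \<alpha> \<beta> T d A (Suc m) n"
proof -
  define p q where "p = d n" "q = d (n+1)"
  note d_defs = this
  have "n - 1 + 2 = n + 1" "n - 2 + 2 = n" using n m by auto
  hence weights_n: "d (n - 1) = q" "d (n - 2) = p"
    using weights(2)[of "n - 1"] weights(2)[of "n - 2"] unfolding d_defs by metis+
  have ix: "n - 2 + 1 = n - 1" "n - 2 + 2 = n" "n - 2 + 3 = n + 1" "n - 2 + 4 = n + 2"
      "n - 1 + 1 = n" "n - 1 + 2 = n + 1" "n - 1 - 1 = n - 2" "n - 1 + m = n + m - 1"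
      "n + m - 1 + 1 = n + m" "n - 1 - m = n - (m + 1)" "Suc m = m + 1" "n + (m + 1) = n + m + 1"
      "m + 1 - 1 = m" "m + 1 + 1 = m + 2"
    using n m by auto
  have ixm: "m - 1 + 1 = m" "m - 1 + 2 = m + 1" "m - 1 + 3 = m + 2" using m by auto
  define a b c' e f where "a = A (n - 2)" "b = A (n - 1)" "c' = A n" "e = A (n+1)" "f = A (n+2)"
  note A_defs = this
  define u v w t where "u = V (m - 1)" "v = V m" "w = V (m + 1)" "t = V (m + 2)"
  note V_defs = this
  define r s where "r = c m" "s = c (m + 1)"
  note c_defs = this
  have weights_m: "c (m - 1) = s" "c (m + 2) = r"
    using m by (auto simp: c_defs parity_weight_def)
  have h1: "p * f * a = \<alpha> * q * e * b + \<beta> * p * c'^2"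
  proof -
    have "d (n-2) * A (n-2+4) * A (n-2) = \<alpha> * d (n-2+1) * A (n-2+3) * A (n-2+1) + \<beta> * d (n-2) * A (n-2+2)^2"
      using somos unfolding weighted_somos4_def by blast
    thus ?thesis unfolding ix weights_n A_defs .
  qed
  have h2: "q * f * b^2 + q * e^2 * a + \<alpha> * p * c'^3 = T * q * b * c' * e"
    using cubic[of "n-2"] unfolding cubic_integral_def ix weights_n A_defs .
  have h3: "s * r * u^2 * t^2 + \<alpha> * (r^2 * v^3 * t + s^2 * u * w^3) + \<beta> * s * r * v^2 * w^2
         = T * s * r * u * v * w * t"
    using companion_integrals(2)[OF alpha_nz companion_nz, of "m - 1"]
    unfolding quartic_integral_def ixm weights_m V_defs c_defs by simp
  have h4: "s * r = \<alpha>" using parity_weights(2)[of m] by (simp add: c_defs mult.commute)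
  have Em: "d (n + m) * A (n + m) * A (n - m) = r * v^2 * q * e * b - s * w * u * p * c'^2"
    using E unfolding even_identity_def A_defs d_defs V_defs c_defs .
  have O1: "A (n + m + 1) * A (n - m) = w * v * f * b - t * u * e * c'"
    using O(1) unfolding odd_identity_def A_defs V_defs .
  have O2: "A (n + m) * A (n - (m + 1)) = w * v * e * a - t * u * c' * b"
    using O(2) unfolding odd_identity_def A_defs V_defs ix .
  have "(d (n + m + 1) * A (n + m + 1) * A (n - (m + 1))) * (d (n + m) * A (n + m) * A (n - m))
    = (d (n + m) * d (n + m + 1)) * ((A (n + m + 1) * A (n - m)) * (A (n + m) * A (n - (m + 1))))"
    by (simp add: mult_ac)
  also have "d (n + m) * d (n + m + 1) = p * q"
    using weights(3)[of "n + m" n] by (simp add: d_defs)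
  also have "p * q * ((A (n + m + 1) * A (n - m)) * (A (n + m) * A (n - (m + 1))))
    = (s * w^2 * q * e * b - r * t * v * p * c'^2) * (d (n + m) * A (n + m) * A (n - m))"
    unfolding Em O1 O2 by (rule even_step[OF h1 h2 h3 h4 alpha_nz, symmetric])
  finally have "d (n + m + 1) * A (n + m + 1) * A (n - (m + 1)) = s * w^2 * q * e * b - r * t * v * p * c'^2"
    using weights(1)[of "n + m"] terms_nz[of "n + m"] terms_nz[of "n - m"] n by simp
  thus ?thesis unfolding even_identity_def ix weights_m A_defs d_defs V_defs c_defs .
qed

text \<open>
  The same regrouping one half step later: the product of \<open>A\<^sub>n\<^sub>+\<^sub>m\<^sub>+\<^sub>2 A\<^sub>n\<^sub>-\<^sub>m\<^sub>-\<^sub>1\<close> and \<open>A\<^sub>n\<^sub>+\<^sub>m\<^sub>+\<^sub>1 A\<^sub>n\<^sub>-\<^sub>m\<close>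
  is split into the left-hand sides of the even identities at \<open>n\<close> and \<open>n + 1\<close>.
\<close>
lemma odd_identity_Suc:
  assumes n: "n > Suc m" and m: "m \<ge> 1"
    and O: "odd_identity \<alpha> \<beta> T A m n"
    and E: "even_identity \<alpha> \<beta> T d A (Suc m) n" "even_identity \<alpha> \<beta> T d A (Suc m) (n + 1)"
  shows "odd_identity \<alpha> \<beta> T A (Suc m) n"
proof -
  define p q where "p = d n" "q = d (n+1)"
  note d_defs = this
  have weights_n: "d (n - 1) = q" "d (n + 2) = p"
    using weights(2)[of "n - 1"] weights(2)[of n] n m
    by (simp_all add: d_defs)
  have ix: "n - 1 + 1 = n" "n - 1 + 2 = n + 1" "n - 1 + 3 = n + 2" "n + 1 + 1 = n + 2"
      "n + 1 - 1 = n" "n + 1 - (m + 1) = n - m" "n + 1 + (m + 1) = n + m + 2" "Suc m = m + 1"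
      "m + 1 - 1 = m" "m + 1 + 1 = m + 2" "m + 1 + 2 = m + 3" "n + (m + 1) = n + m + 1"
      "n + m + 1 + 1 = n + m + 2"
    using n m by auto
  have ixm: "m - 1 + 1 = m" "m - 1 + 2 = m + 1" "m - 1 + 3 = m + 2" "m - 1 + 4 = m + 3"
    using m by auto
  define b c' e f where "b = A (n - 1)" "c' = A n" "e = A (n+1)" "f = A (n+2)"
  note A_defs = this
  define y u v w t where "y = V (m - 1)" "u = V m" "v = V (m + 1)" "w = V (m + 2)" "t = V (m + 3)"
  note V_defs = this
  define r s where "r = c (m + 1)" "s = c m"
  note c_defs = this
  have weights_m: "c (m - 1) = r" "c (m + 2) = s"
    using m by (auto simp: c_defs parity_weight_def)
  have h1: "q * p * b^2 * f^2 + \<alpha> * (p^2 * c'^3 * f + q^2 * b * e^3) + \<beta> * q * p * c'^2 * e^2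
         = T * q * p * b * c' * e * f"
    using quartic[of "n - 1"] unfolding quartic_integral_def ix weights_n A_defs d_defs .
  have h2: "r * t * y = \<alpha> * s * w * u + \<beta> * r * v^2"
  proof -
    have "c (m-1) * V (m-1+4) * V (m-1) = \<alpha> * c (m-1+1) * V (m-1+3) * V (m-1+1) + \<beta> * c (m-1) * V (m-1+2)^2"
      using companion_weighted_somos4[OF alpha_nz companion_nz] unfolding weighted_somos4_def by blast
    thus ?thesis unfolding ixm weights_m V_defs c_defs .
  qed
  have h3: "s * t * u^2 + s * w^2 * y + \<alpha> * r * v^3 = T * s * u * v * w"
    using companion_integrals(1)[OF alpha_nz companion_nz, of "m - 1"]
    unfolding cubic_integral_def ixm weights_m V_defs c_defs by simp
  have h4: "r * s = \<alpha>" using parity_weights(2)[of m] by (simp add: c_defs mult.commute)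
  have E1: "d (n + m + 1) * A (n + m + 1) * A (n - (m + 1)) = r * v^2 * q * e * b - s * w * u * p * c'^2"
    using E(1) unfolding even_identity_def ix weights_m A_defs d_defs V_defs c_defs .
  have E2: "d (n + m + 2) * A (n + m + 2) * A (n - m) = r * v^2 * p * f * c' - s * w * u * q * e^2"
    using E(2) unfolding even_identity_def ix weights_m weights_n A_defs d_defs V_defs c_defs .
  have Om: "A (n + m + 1) * A (n - m) = v * u * f * b - w * y * e * c'"
    using O unfolding odd_identity_def ix A_defs V_defs .
  have pq: "d (n + m + 1) * d (n + m + 2) = p * q"
    using weights(3)[of "n + m + 1" n] by (simp add: d_defs)
  have "p * q * ((A (n + m + 2) * A (n - (m + 1))) * (A (n + m + 1) * A (n - m)))
      = (d (n + m + 1) * A (n + m + 1) * A (n - (m + 1))) * (d (n + m + 2) * A (n + m + 2) * A (n - m))"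
    by (simp add: mult_ac flip: pq)
  also have "\<dots> = p * q * ((w * v * f * b - t * u * e * c') * (A (n + m + 1) * A (n - m)))"
    unfolding E1 E2 Om by (rule odd_step[OF h1 h2 h3 h4 alpha_nz])
  finally have "A (n + m + 2) * A (n - (m + 1)) = w * v * f * b - t * u * e * c'"
    using weights(1) terms_nz[of "n + m + 1"] terms_nz[of "n - m"] n by (simp add: d_defs)
  thus ?thesis unfolding odd_identity_def ix A_defs V_defs .
qed

lemma elliptic_identities:
  assumes "m \<ge> 1" "n > m"
  shows "even_identity \<alpha> \<beta> T d A m n" and "odd_identity \<alpha> \<beta> T A m n"
proof -
  have "(\<forall>n>m. even_identity \<alpha> \<beta> T d A m n) \<and> (\<forall>n>m. odd_identity \<alpha> \<beta> T A m n)"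
    using \<open>m \<ge> 1\<close>
  proof (induction m rule: dec_induct)
    case base
    show ?case
      by (simp add: even_identity_def odd_identity_def parity_weight_def eval_nat_numeral)
  next
    case (step m)
    have E: "even_identity \<alpha> \<beta> T d A (Suc m) n" if "n > Suc m" for n
      using step that by (intro even_identity_Suc) auto
    have "odd_identity \<alpha> \<beta> T A (Suc m) n" if "n > Suc m" for n
      using step that E by (intro odd_identity_Suc) auto
    thus ?case using E by blast
  qed
  thus "even_identity \<alpha> \<beta> T d A m n" "odd_identity \<alpha> \<beta> T A m n" using assms by auto
qed

text \<open>
  The identities at the centre \<open>m + 1\<close> express \<open>A (2 * m + 1) * A 1\<close> and \<open>A (2 * m + 2) * A 1\<close> through
  terms of index at most \<open>m + 2\<close> and \<open>m + 3\<close>. These are earlier terms as soon as \<open>m \<ge> 2\<close>, that is, from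
  index 5 on. The only division needed to recover the new term is by \<open>A 1\<close>.
\<close>
lemma term_product_in_subring:
  assumes S: "subring_set S" and "\<alpha> \<in> S" and dS: "\<And>j. d j \<in> S"
    and "n \<ge> 5" and V: "\<And>j. j < n \<Longrightarrow> V j \<in> S" and A: "\<And>j. 1 \<le> j \<Longrightarrow> j < n \<Longrightarrow> A j \<in> S"
  shows "d 1 * A n * A 1 \<in> S"
proof -
  have cS: "c j \<in> S" for j
    using \<open>\<alpha> \<in> S\<close> subring_setD(2)[OF S] by (simp add: parity_weight_def)
  note closed = subring_setD(3,4,7)[OF S]
  obtain m where m: "n = 2 * m + 1 \<or> n = 2 * m + 2" "m \<ge> 2"
  proof
    show "n = 2 * ((n - 1) div 2) + 1 \<or> n = 2 * ((n - 1) div 2) + 2" "(n - 1) div 2 \<ge> 2"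
      using \<open>n \<ge> 5\<close> by presburger+
  qed
  from m(1) show ?thesis
  proof
    assume n: "n = 2 * m + 1"
    have "d (2 * k + 1) = d 1" for k
      by (induction k) (use weights(2) in \<open>auto simp: numeral_2_eq_2\<close>)
    from this[of m]
    have "d n = d 1" by (simp add: n)
    moreover have "m + 1 + m = n" "m + 1 - m = 1" "m + 1 - 1 = m" "m + 1 + 1 = m + 2" using n by auto
    ultimately have "d 1 * A n * A 1 = c m * V m ^ 2 * d (m + 2) * A (m + 2) * A m
        - c (m + 1) * V (m + 1) * V (m - 1) * d (m + 1) * A (m + 1) ^ 2"
      using elliptic_identities(1)[of m "m + 1"] m n by (simp add: even_identity_def mult_2)
    thus ?thesis using m n by (auto intro!: closed cS dS V A)
  next
    assume n: "n = 2 * m + 2"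
    have ix: "m + 1 + m + 1 = n" "m + 1 - m = 1" "m + 1 - 1 = m" "m + 1 + 1 = m + 2" "m + 1 + 2 = m + 3"
      using n by auto
    have "odd_identity \<alpha> \<beta> T A m (m + 1)"
      by (rule elliptic_identities) (use m in auto)
    hence "A n * A 1 = V (m + 1) * V m * A (m + 3) * A m - V (m + 2) * V (m - 1) * A (m + 2) * A (m + 1)"
      unfolding odd_identity_def ix .
    moreover have "V (m + 1) * V m * A (m + 3) * A m - V (m + 2) * V (m - 1) * A (m + 2) * A (m + 1) \<in> S"
      using m n by (auto intro!: closed V A)
    ultimately show ?thesis using closed(2)[OF dS[of 1]] by (simp add: mult.assoc)
  qed
qed

end

section \<open>Integrality in terms of the conserved quantity\<close>

text \<open>
  The companion sequence is itself a weighted Somos 4 sequence with conserved quantity \<open>T\<close>, so the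
  identities hold with \<open>A = V\<close>; as \<open>V 1 = 1\<close>, they become division-free doubling formulas.
\<close>
lemma companion_in_subring:
  assumes "\<alpha> \<noteq> 0" "\<And>n. n \<ge> 1 \<Longrightarrow> companion \<alpha> \<beta> T n \<noteq> 0"
    and S: "subring_set S" "\<alpha> \<in> S" "\<beta> \<in> S" "\<alpha>\<^sup>2 + \<beta> * T \<in> S"
  shows "companion \<alpha> \<beta> T n \<in> S"
proof (induction n rule: less_induct)
  case (less n)
  show ?case
  proof (cases "n < 5")
    case True
    hence "n \<in> {0, 1, 2, 3, 4}" by auto
    moreover have "companion \<alpha> \<beta> T 2 = 1" "companion \<alpha> \<beta> T 3 = - \<beta>"
      "companion \<alpha> \<beta> T 4 = - (\<alpha>\<^sup>2 + \<beta> * T)"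
      by (simp_all add: eval_nat_numeral)
    ultimately show ?thesis
      using subring_setD(1,2)[OF S(1)] subring_setD(5)[OF S(1) S(3)] subring_setD(5)[OF S(1) S(4)]
      by (elim insertE emptyE) simp_all
  next
    case False
    have dS: "parity_weight \<alpha> j \<in> S" for j
      using S subring_setD(2)[OF S(1)] by (simp add: parity_weight_def)
    have "parity_weight \<alpha> 1 * companion \<alpha> \<beta> T n * companion \<alpha> \<beta> T 1 \<in> S"
      by (rule term_product_in_subring[OF assms(1,2) companion_weighted_somos4[OF assms(1,2)]
            companion_integrals[OF assms(1,2)] S(1,2) dS]) (use less False in auto)
    thus ?thesis by (simp add: parity_weight_def)
  qed
qed

text \<open>
  The strong Laurent property. Membership in an arbitrary subring, instead of being a value of a
  polynomial, is the form in which it is used: the subring will consist of the rational functions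
  with \<open>p\<close>-integral value at a given point.
\<close>
lemma terms_in_subring:
  assumes "\<alpha> \<noteq> 0" "\<And>n. n \<ge> 1 \<Longrightarrow> companion \<alpha> \<beta> T n \<noteq> 0"
    and W: "weighted_somos4 \<alpha> \<beta> (\<lambda>_. 1) A"
    and C: "\<And>n. cubic_integral \<alpha> T (\<lambda>_. 1) A n" and Q: "\<And>n. quartic_integral \<alpha> \<beta> T (\<lambda>_. 1) A n"
    and S: "subring_set S" "\<alpha> \<in> S" "\<beta> \<in> S" "\<alpha>\<^sup>2 + \<beta> * T \<in> S"
    and A: "inverse (A 1) \<in> S" "A 1 \<in> S" "A 2 \<in> S" "A 3 \<in> S" "A 4 \<in> S"
    and "n \<ge> 1"
  shows "A n \<in> S"
  using \<open>n \<ge> 1\<close>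
proof (induction n rule: less_induct)
  case (less n)
  show ?case
  proof (cases "n < 5")
    case True
    hence "n = 1 \<or> n = 2 \<or> n = 3 \<or> n = 4" using less by auto
    thus ?thesis using A by auto
  next
    case False
    have "1 * A n * A 1 \<in> S"
      by (rule term_product_in_subring[OF assms(1,2) W C Q S(1,2) subring_setD(2)[OF S(1)]])
        (use less False companion_in_subring[OF assms(1,2) S] in auto)
    moreover have "A 1 \<noteq> 0" using W by (auto simp: weighted_somos4_def)
    ultimately show ?thesis
      using subring_setD(4)[OF S(1) _ A(1), of "A n * A 1"] by (simp add: mult.assoc)
  qed
qed

section \<open>Values of rational functions\<close>

text \<open>
  A relation rather than a function, so that being defined at a point is inherited by sums,
  products and quotients along with the value.
\<close>
definition fract_value :: "('r::idom \<Rightarrow> 'a::field) \<Rightarrow> 'r fract \<Rightarrow> 'a \<Rightarrow> bool" where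
  "fract_value h f v \<longleftrightarrow>
     (\<exists>P Q. f = to_fract P / to_fract Q \<and> h Q \<noteq> 0 \<and> v = h P / h Q)"

context
  fixes h :: "'r::idom \<Rightarrow> 'a::field"
  assumes hom: "is_ring_hom h"
begin

lemma hom_simps: "h 0 = 0" "h 1 = 1" "h (x + y) = h x + h y" "h (x * y) = h x * h y"
    "h (x - y) = h x - h y"
proof -
  show *: "h 0 = 0" "h 1 = 1" "h (x + y) = h x + h y" "h (x * y) = h x * h y" for x y
    using hom by (auto simp: is_ring_hom_def)
  show "h (x - y) = h x - h y" using *(3)[of "x - y" y] by simp
qed

lemma fract_value_to_fract: "fract_value h (to_fract P) (h P)"
  unfolding fract_value_def by (rule exI[of _ P], rule exI[of _ 1]) (simp add: hom_simps)

lemma fract_value_arith: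
  assumes "fract_value h f v" "fract_value h g w"
  shows "fract_value h (f + g) (v + w)" "fract_value h (f - g) (v - w)" "fract_value h (f * g) (v * w)"
    "w \<noteq> 0 \<Longrightarrow> fract_value h (f / g) (v / w)"
proof -
  obtain P Q where f: "f = to_fract P / to_fract Q" "h Q \<noteq> 0" "v = h P / h Q"
    using assms(1) by (auto simp: fract_value_def)
  obtain P' Q' where g: "g = to_fract P' / to_fract Q'" "h Q' \<noteq> 0" "w = h P' / h Q'"
    using assms(2) by (auto simp: fract_value_def)
  have nz: "Q \<noteq> 0" "Q' \<noteq> 0" using f g hom_simps by auto
  show "fract_value h (f + g) (v + w)" unfolding fract_value_def
    by (rule exI[of _ "P * Q' + P' * Q"], rule exI[of _ "Q * Q'"])
      (use f(2) g(2) nz in \<open>simp add: f(1,3) g(1,3) hom_simps add_frac_eq diff_frac_eq\<close>)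
  show "fract_value h (f - g) (v - w)" unfolding fract_value_def
    by (rule exI[of _ "P * Q' - P' * Q"], rule exI[of _ "Q * Q'"])
      (use f(2) g(2) nz in \<open>simp add: f(1,3) g(1,3) hom_simps add_frac_eq diff_frac_eq\<close>)
  show "fract_value h (f * g) (v * w)" unfolding fract_value_def
    by (rule exI[of _ "P * P'"], rule exI[of _ "Q * Q'"])
      (use f g nz in \<open>simp add: hom_simps\<close>)
  show "fract_value h (f / g) (v / w)" if "w \<noteq> 0" unfolding fract_value_def
    by (rule exI[of _ "P * Q'"], rule exI[of _ "Q * P'"])
      (use f g nz that in \<open>simp add: hom_simps\<close>)
qed

lemma fract_value_power: "fract_value h f v \<Longrightarrow> fract_value h (f ^ n) (v ^ n)"
proof (induction n)
  case 0
  show ?case using fract_value_to_fract[of 1] by (simp add: hom_simps)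
qed (auto intro: fract_value_arith)

lemma fract_value_nonzero: "fract_value h f v \<Longrightarrow> v \<noteq> 0 \<Longrightarrow> f \<noteq> 0"
  using hom_simps by (auto simp: fract_value_def)

lemma fract_value_subring:
  assumes "subring_set R"
  shows "subring_set {f. \<exists>v\<in>R. fract_value h f v}"
  unfolding subring_set_def
proof (intro conjI ballI)
  have "fract_value h 1 1" using fract_value_to_fract[of 1] by (simp add: hom_simps)
  thus "1 \<in> {f. \<exists>v\<in>R. fract_value h f v}" using subring_setD(2)[OF assms] by blast
  fix f g
  assume "f \<in> {f. \<exists>v\<in>R. fract_value h f v}" "g \<in> {f. \<exists>v\<in>R. fract_value h f v}"
  then obtain v w where "v \<in> R" "w \<in> R" "fract_value h f v" "fract_value h g w" by blast
  thus "f - g \<in> {f. \<exists>v\<in>R. fract_value h f v}" "f * g \<in> {f. \<exists>v\<in>R. fract_value h f v}"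
    using fract_value_arith(2,3) subring_setD(3,4)[OF assms] by blast+
qed

end

section \<open>The formal sequence\<close>

abbreviation "f\<alpha> \<equiv> to_fract var_alpha"
abbreviation "f\<beta> \<equiv> to_fract var_beta"
abbreviation "F \<equiv> somos4_formal"

definition formal_T :: "pol6 fract" where
  "formal_T = (F 1 ^ 2 * F 4 ^ 2 + f\<alpha> * (F 2 ^ 3 * F 4 + F 1 * F 3 ^ 3) + f\<beta> * F 2 ^ 2 * F 3 ^ 2)
     / (F 1 * F 2 * F 3 * F 4)"

text \<open>
  The identities divide by terms of the companion sequence, so these must not vanish identically. At the point
  \<open>\<alpha> = 4\<close>, \<open>\<beta> = -3\<close>, \<open>A\<^sub>i = i\<close> the Somos 4 sequence is \<open>A\<^sub>n = n\<close>, the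
  conserved quantity is 6, and \<open>W\<^sub>m = m\<close>: the elliptic curve degenerates to the additive group.
\<close>
lemma formal_companion_nonzero:
  assumes "n \<ge> 1"
  shows "companion f\<alpha> f\<beta> formal_T n \<noteq> 0"
proof -
  define h :: "pol6 \<Rightarrow> rat" where "h = eval6 4 (- 3) 1 2 3 4"
  have hom: "is_ring_hom h" unfolding h_def by (rule is_ring_hom_eval6)
  note ar = fract_value_arith[OF hom] fract_value_power[OF hom]
  have val: "fract_value h f\<alpha> 4" "fract_value h f\<beta> (- 3)"
      "fract_value h (F 1) 1" "fract_value h (F 2) 2" "fract_value h (F 3) 3" "fract_value h (F 4) 4"
    using fract_value_to_fract[OF hom, of var_alpha] fract_value_to_fract[OF hom, of var_beta]
      fract_value_to_fract[OF hom, of var_A1] fract_value_to_fract[OF hom, of var_A2]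
      fract_value_to_fract[OF hom, of var_A3] fract_value_to_fract[OF hom, of var_A4]
    by (simp_all add: h_def somos4_formal_init)
  have "fract_value h formal_T ((1^2 * 4^2 + 4 * (2^3 * 4 + 1 * 3^3) + (-3) * 2^2 * 3^2) / (1 * 2 * 3 * 4))"
    unfolding formal_T_def by (intro ar val) auto
  hence T: "fract_value h formal_T 6" by simp
  have const: "fract_value h 0 0" "fract_value h 1 1"
    using fract_value_to_fract[OF hom, of 0] fract_value_to_fract[OF hom, of 1]
    by (simp_all add: hom_simps[OF hom])
  define v :: "nat \<Rightarrow> rat" where "v n = of_nat n / (if even n then 2 else 1)" for n
  have "fract_value h (companion f\<alpha> f\<beta> formal_T n) (v n)" for n
  proof (induction f\<alpha> f\<beta> formal_T n rule: companion.induct)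
    case 1
    show ?case using const by (simp add: v_def)
  next
    case 2
    show ?case using const by (simp add: v_def)
  next
    case 3
    show ?case using const by (simp add: v_def)
  next
    case 4
    have "fract_value h (0 - f\<beta>) (0 - (- 3))" by (intro ar const val)
    thus ?case by (simp add: v_def)
  next
    case 5
    have "fract_value h (0 - (f\<alpha>\<^sup>2 + f\<beta> * formal_T)) (0 - (4\<^sup>2 + (- 3) * 6))"
      by (intro ar const val T)
    thus ?case by (simp add: v_def)
  next
    case (6 n)
    define k :: rat where "k = (if even n then 4\<^sup>2 else 1)"
    have k: "fract_value h (if even n then f\<alpha>\<^sup>2 else 1) k"
      using fract_value_power[OF hom val(1), of 2] const by (simp add: k_def)
    have "fract_value h (companion f\<alpha> f\<beta> formal_T (Suc (Suc (Suc (Suc (Suc n))))))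
        ((k * v (Suc (Suc (Suc (Suc n)))) * v (Suc (Suc n)) + (- 3) * (v (Suc (Suc (Suc n))))\<^sup>2) / v (Suc n))"
      unfolding companion.simps by (intro ar val k 6) (simp add: v_def)
    also have "(k * v (Suc (Suc (Suc (Suc n)))) * v (Suc (Suc n)) + (- 3) * (v (Suc (Suc (Suc n))))\<^sup>2) / v (Suc n)
        = v (Suc (Suc (Suc (Suc (Suc n)))))"
    proof -
      have "of_nat n + 1 \<noteq> (0::rat)" by (metis of_nat_Suc of_nat_neq_0 add.commute)
      thus ?thesis
        by (auto simp: v_def k_def divide_simps) (auto simp: algebra_simps power2_eq_square)
    qed
    finally show ?case .
  qed
  moreover have "v n \<noteq> 0" using assms by (simp add: v_def)
  ultimately show ?thesis using fract_value_nonzero[OF hom] by blast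
qed

text \<open>
  The recurrence is symmetric, so the formal sequence may be read in both directions from any index.
\<close>
lemma formal_run_weighted_somos4:
  assumes "\<sigma> = 1 \<or> \<sigma> = - 1"
  shows "weighted_somos4 f\<alpha> f\<beta> (\<lambda>_. 1) (\<lambda>n. F (j + \<sigma> * int n))"
proof -
  have "F (j + \<sigma> * int (n + 4)) * F (j + \<sigma> * int n) =
      f\<alpha> * F (j + \<sigma> * int (n + 3)) * F (j + \<sigma> * int (n + 1)) + f\<beta> * F (j + \<sigma> * int (n + 2)) ^ 2" for n
  proof -
    from assms show ?thesis
    proof
      assume "\<sigma> = 1"
      thus ?thesis using somos4_formal_rec[of "j + int n"] by (simp add: add_ac)
    next
      assume "\<sigma> = - 1"
      define b where "b = j - int n - 4"
      have ix: "j + \<sigma> * int n = b + 4" "j + \<sigma> * int (n + 1) = b + 3" "j + \<sigma> * int (n + 2) = b + 2"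
        "j + \<sigma> * int (n + 3) = b + 1" "j + \<sigma> * int (n + 4) = b"
        using \<open>\<sigma> = - 1\<close> by (auto simp: b_def)
      show ?thesis using somos4_formal_rec[of b] unfolding ix by (simp add: mult_ac)
    qed
  qed
  thus ?thesis by (simp add: weighted_somos4_def somos4_formal_nonzero)
qed

lemma formal_quartic:
  "F j ^ 2 * F (j + 3) ^ 2 + f\<alpha> * (F (j + 1) ^ 3 * F (j + 3) + F j * F (j + 2) ^ 3)
     + f\<beta> * F (j + 1) ^ 2 * F (j + 2) ^ 2 = formal_T * F j * F (j + 1) * F (j + 2) * F (j + 3)"
proof -
  have T: "F 1 ^ 2 * F 4 ^ 2 + f\<alpha> * (F 2 ^ 3 * F 4 + F 1 * F 3 ^ 3) + f\<beta> * F 2 ^ 2 * F 3 ^ 2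
      = formal_T * F 1 * F 2 * F 3 * F 4"
    using somos4_formal_nonzero by (simp add: formal_T_def)
  show ?thesis
  proof (cases "j \<ge> 1")
    case True
    let ?A = "\<lambda>n. F (1 + 1 * int n)"
    have W: "weighted_somos4 f\<alpha> f\<beta> (\<lambda>_. 1) ?A"
      by (rule formal_run_weighted_somos4) simp
    have Q: "quartic_integral f\<alpha> f\<beta> formal_T (\<lambda>_. 1) ?A 0"
      using T by (simp add: quartic_integral_def)
    have "quartic_integral f\<alpha> f\<beta> formal_T (\<lambda>_. 1) ?A (nat (j - 1))"
      by (rule integrals_conserved(2)[OF W quartic_imp_cubic[OF W Q] Q])
        (simp add: somos4_formal_nonzero)
    moreover have ix: "1 + 1 * int (nat (j - 1)) = j" "1 + 1 * int (nat (j - 1) + 1) = j + 1"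
      "1 + 1 * int (nat (j - 1) + 2) = j + 2" "1 + 1 * int (nat (j - 1) + 3) = j + 3"
      using True by auto
    ultimately show ?thesis unfolding quartic_integral_def ix by simp
  next
    case False
    let ?A = "\<lambda>n. F (4 + (- 1) * int n)"
    have W: "weighted_somos4 f\<alpha> f\<beta> (\<lambda>_. 1) ?A"
      by (rule formal_run_weighted_somos4) simp
    have Q: "quartic_integral f\<alpha> f\<beta> formal_T (\<lambda>_. 1) ?A 0"
      using T by (simp add: quartic_integral_def algebra_simps)
    have "quartic_integral f\<alpha> f\<beta> formal_T (\<lambda>_. 1) ?A (nat (1 - j))"
      by (rule integrals_conserved(2)[OF W quartic_imp_cubic[OF W Q] Q])
        (simp add: somos4_formal_nonzero)
    moreover have ix: "4 + (- 1) * int (nat (1 - j) + 1) = j + 2" "4 + (- 1) * int (nat (1 - j)) = j + 3"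
      "4 + (- 1) * int (nat (1 - j) + 2) = j + 1" "4 + (- 1) * int (nat (1 - j) + 3) = j"
      using False by auto
    ultimately show ?thesis unfolding quartic_integral_def ix by (simp add: mult_ac add_ac)
  qed
qed

lemma formal_run_integrals:
  assumes "\<sigma> = 1 \<or> \<sigma> = - 1"
  shows "quartic_integral f\<alpha> f\<beta> formal_T (\<lambda>_. 1) (\<lambda>n. F (j + \<sigma> * int n)) n"
    and "cubic_integral f\<alpha> formal_T (\<lambda>_. 1) (\<lambda>n. F (j + \<sigma> * int n)) n"
proof -
  show Q: "quartic_integral f\<alpha> f\<beta> formal_T (\<lambda>_. 1) (\<lambda>n. F (j + \<sigma> * int n)) n"
    using assms
  proof
    assume "\<sigma> = 1"
    thus ?thesis using formal_quartic[of "j + int n"] by (simp add: quartic_integral_def add_ac)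
  next
    assume "\<sigma> = - 1"
    define b where "b = j - int n - 3"
    have ix: "j + \<sigma> * int n = b + 3" "j + \<sigma> * int (n + 1) = b + 2" "j + \<sigma> * int (n + 2) = b + 1"
      "j + \<sigma> * int (n + 3) = b"
      using \<open>\<sigma> = - 1\<close> by (auto simp: b_def)
    show ?thesis using formal_quartic[of b]
      unfolding quartic_integral_def ix by (simp add: mult_ac add_ac)
  qed
  show "cubic_integral f\<alpha> formal_T (\<lambda>_. 1) (\<lambda>n. F (j + \<sigma> * int n)) n"
    by (rule quartic_imp_cubic[OF formal_run_weighted_somos4[OF assms] Q somos4_formal_nonzero])
qed

lemma formal_alpha_nonzero: "f\<alpha> \<noteq> 0"
  using vars_pos(1) by (metis less_irrefl)

text \<open>
  The odd identity for \<open>m = 2\<close>. It determines the value of \<open>\<alpha>\<^sup>2 + \<beta> T\<close> from six consecutive terms.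
\<close>
lemma formal_somos5:
  "F (j + 5) * F j = (f\<alpha>\<^sup>2 + f\<beta> * formal_T) * F (j + 3) * F (j + 2) - f\<beta> * F (j + 4) * F (j + 1)"
proof -
  let ?A = "\<lambda>n. F ((j - 1) + 1 * int n)"
  have one: "(1::int) = 1 \<or> (1::int) = - 1" by simp
  have V: "companion f\<alpha> f\<beta> formal_T 2 = 1" "companion f\<alpha> f\<beta> formal_T 3 = - f\<beta>"
    "companion f\<alpha> f\<beta> formal_T 4 = - (f\<alpha>\<^sup>2 + f\<beta> * formal_T)"
    by (simp_all add: eval_nat_numeral)
  have "odd_identity f\<alpha> f\<beta> formal_T ?A 2 3"
    by (rule elliptic_identities(2)[OF formal_alpha_nonzero formal_companion_nonzero
          formal_run_weighted_somos4[OF one] formal_run_integrals(2,1)[OF one]]) auto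
  thus ?thesis by (simp add: odd_identity_def V algebra_simps)
qed

text \<open>
  The terms of index \<open>j, ..., j + 3\<close> generate the sequence to the right, and those of index
  \<open>j, ..., j - 3\<close> generate it to the left, each time with \<open>F j\<close> as the only denominator.
\<close>
lemma formal_terms_in_subring:
  assumes S: "subring_set S" "f\<alpha> \<in> S" "f\<beta> \<in> S" "f\<alpha>\<^sup>2 + f\<beta> * formal_T \<in> S"
    and inv: "inverse (F j) \<in> S" and near: "\<And>i. i \<in> {-3..3} \<Longrightarrow> F (j + i) \<in> S"
  shows "F n \<in> S"
proof -
  have run: "F (j + \<sigma> * int k) \<in> S" if \<sigma>: "\<sigma> = 1 \<or> \<sigma> = - 1" for \<sigma> k
  proof -
    \<comment> \<open>The starting index is shifted because the term of index 1 is the one that is inverted.\<close>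
    have "F ((j - \<sigma>) + \<sigma> * int (Suc k)) \<in> S"
      by (rule terms_in_subring[OF formal_alpha_nonzero formal_companion_nonzero
            formal_run_weighted_somos4[OF \<sigma>] formal_run_integrals(2,1)[OF \<sigma>] S])
        (use \<sigma> inv near[of 0] near[of \<sigma>] near[of "2 * \<sigma>"] near[of "3 * \<sigma>"] in \<open>auto simp: algebra_simps\<close>)
    thus ?thesis by (simp add: algebra_simps)
  qed
  show ?thesis
  proof (cases "n \<ge> j")
    case True
    thus ?thesis using run[of 1 "nat (n - j)"] by simp
  next
    case False
    thus ?thesis using run[of "- 1" "nat (j - n)"] by simp
  qed
qed

section \<open>Localisation at a prime\<close>

definition p_integral :: "int \<Rightarrow> 'a::field_char_0 set" where
  "p_integral p = {of_int a / of_int b |a b. \<not> p dvd b}"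

lemma p_integralI: "\<not> p dvd b \<Longrightarrow> x * of_int b = of_int a \<Longrightarrow> x \<in> p_integral p"
proof -
  assume "\<not> p dvd b" "x * of_int b = of_int a"
  moreover from this have "b \<noteq> 0" by auto
  ultimately show ?thesis unfolding p_integral_def by (auto simp: eq_divide_eq)
qed

lemma p_integralE:
  assumes "x \<in> p_integral p"
  obtains a b where "\<not> p dvd b" "x * of_int b = of_int a"
proof -
  obtain a b where "\<not> p dvd b" "x = of_int a / of_int b"
    using assms by (auto simp: p_integral_def)
  moreover from this have "b \<noteq> 0" by auto
  ultimately show ?thesis using that by auto
qed

lemma subring_p_integral:
  assumes "prime p"
  shows "subring_set (p_integral p :: 'a::field_char_0 set)"
  unfolding subring_set_def
proof (intro conjI ballI)
  show "(1::'a) \<in> p_integral p"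
    by (rule p_integralI[of _ 1 _ 1]) (use assms not_prime_unit in auto)
  fix x y :: 'a
  assume "x \<in> p_integral p" "y \<in> p_integral p"
  then obtain a b a' b' where x: "\<not> p dvd b" "x * of_int b = of_int a"
    and y: "\<not> p dvd b'" "y * of_int b' = of_int a'" by (meson p_integralE)
  have b: "\<not> p dvd b * b'" using x(1) y(1) assms by (simp add: prime_dvd_mult_iff)
  have "(x - y) * of_int (b * b') = (x * of_int b) * of_int b' - (y * of_int b') * of_int b"
    by (simp add: algebra_simps)
  also have "\<dots> = of_int (a * b' - a' * b)" unfolding x y by simp
  finally show "x - y \<in> p_integral p" using p_integralI[OF b] by blast
  have "(x * y) * of_int (b * b') = (x * of_int b) * (y * of_int b')"
    by simp
  also have "\<dots> = of_int (a * a')" unfolding x y by simp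
  finally show "x * y \<in> p_integral p" using p_integralI[OF b] by blast
qed

lemma of_int_p_integral: "prime p \<Longrightarrow> of_int a \<in> p_integral p"
  by (rule p_integralI[of _ 1 _ a]) (use not_prime_unit in auto)

lemma inverse_p_integral: "\<not> p dvd b \<Longrightarrow> inverse (of_int b) \<in> p_integral p"
  by (cases "b = 0") (auto intro: p_integralI[of _ b _ 1])

text \<open>The localisation at \<open>p\<close> is a valuation ring.\<close>
lemma p_integral_total:
  assumes "prime p" "u \<noteq> 0 \<or> w \<noteq> 0"
  shows "(u \<noteq> 0 \<and> of_int w / of_int u \<in> (p_integral p :: 'a::field_char_0 set)) \<or>
    (w \<noteq> 0 \<and> of_int u / of_int w \<in> (p_integral p :: 'a set))"
proof -
  obtain u' w' where g: "u = gcd u w * u'" "w = gcd u w * w'" "coprime u' w'"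
    using assms(2) gcd_coprime_exists[of u w] by (metis gcd_eq_0_iff mult.commute)
  have "\<not> p dvd u' \<or> \<not> p dvd w'"
    using g(3) assms(1) coprime_common_divisor[of u' w' p] not_prime_unit by blast
  moreover have "w * u' = u * w'" using g(1,2) by (metis mult.assoc mult.commute)
  hence *: "(of_int w * of_int u' :: 'a) = of_int u * of_int w'" by (metis of_int_mult)
  moreover have "u \<noteq> 0" if "\<not> p dvd u'" using that g assms(2) by (metis dvd_0_right mult_eq_0_iff gcd_eq_0_iff)
  moreover have "w \<noteq> 0" if "\<not> p dvd w'" using that g assms(2) by (metis dvd_0_right mult_eq_0_iff gcd_eq_0_iff)
  ultimately show ?thesis
    using p_integralI[of p u' "of_int w / of_int u :: 'a" w'] p_integralI[of p w' "of_int u / of_int w :: 'a" u']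
    by (auto simp: field_simps)
qed

lemma Ints_if_p_integral:
  fixes x :: "'a::field_char_0"
  assumes "\<And>p. prime p \<Longrightarrow> x \<in> p_integral p"
  shows "x \<in> \<int>"
proof -
  obtain a b where ab: "x * of_int b = of_int a" "b \<noteq> 0"
    using assms[of 2] p_integralE[of x 2] by (metis dvd_0_right two_is_prime_nat prime_int_numeral_eq)
  obtain a' b' where g: "a = a' * gcd a b" "b = b' * gcd a b" "coprime a' b'"
    using ab(2) gcd_coprime_exists[of a b] by (metis gcd_eq_0_iff)
  have x: "x * of_int b' = of_int a'"
  proof -
    have "(x * of_int b') * of_int (gcd a b) = of_int a' * of_int (gcd a b)"
      using ab(1) g(1,2) by (metis mult.assoc of_int_mult)
    thus ?thesis using ab(2) by simp
  qed
  have "is_unit b'"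
  proof (rule ccontr)
    assume "\<not> is_unit b'"
    moreover have "b' \<noteq> 0" using g(2) ab(2) by auto
    ultimately obtain p where p: "prime p" "p dvd b'" by (meson prime_divisor_exists)
    obtain c d where cd: "\<not> p dvd d" "x * of_int d = of_int c"
      using assms[OF p(1)] by (rule p_integralE)
    have "of_int (a' * d) = (of_int (c * b') :: 'a)"
      using x cd(2) by (metis mult.assoc mult.commute of_int_mult)
    hence "a' * d = c * b'" by (simp only: of_int_eq_iff)
    hence "p dvd a' * d" using p(2) by simp
    hence "p dvd a'" using cd(1) p(1) by (simp add: prime_dvd_mult_iff)
    thus False using p g(3) coprime_common_divisor not_prime_unit by blast
  qed
  hence "b' * b' = 1" by (auto simp: zdvd1_eq abs_if split: if_splits)
  hence "x = of_int (a' * b')" using x by (metis mult.assoc mult.right_neutral of_int_mult of_int_1)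
  thus ?thesis by simp
qed

text \<open>
  Let \<open>u'', u', u, y, w, w', w''\<close> be seven consecutive terms of a Somos 4 sequence, up to
  reversal, and let \<open>i\<close> be the value of \<open>\<alpha>\<^sup>2 + \<beta> T\<close>. The equation for \<open>i\<close> has the form
  \<open>i u y = w' u'' + \<beta> w u'\<close>, where \<open>y\<close> is prime to \<open>p\<close>. So it suffices that \<open>u\<close> divides \<open>w\<close> and
  \<open>w'\<close> in the localisation. The former is assumed; the latter is clear if \<open>p\<close> does
  not divide \<open>u\<close>, and otherwise follows from \<open>\<alpha> w' y = u w'' - \<beta> w\<^sup>2\<close>, as \<open>\<alpha>\<close> is then a unit.
\<close>
lemma invariant_p_integral_aux:
  fixes i :: "'a::field_char_0" and p :: int
  assumes p: "prime p" and y: "\<not> p dvd y" and u: "u \<noteq> 0"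
    and le: "of_int w / of_int u \<in> (p_integral p :: 'a set)"
    and unit: "\<not> p dvd u \<or> \<not> p dvd \<alpha>"
    and i: "i * of_int u * of_int y = of_int (w' * u'' + \<beta> * w * u')"
    and rec: "u * w'' = \<alpha> * w' * y + \<beta> * w\<^sup>2"
  shows "i \<in> p_integral p"
proof -
  let ?R = "p_integral p :: 'a set"
  note closed = subring_setD(3,4,6)[OF subring_p_integral[OF p]] of_int_p_integral[OF p]
    inverse_p_integral
  have nz: "(of_int u :: 'a) \<noteq> 0" "(of_int y :: 'a) \<noteq> 0" using u y by auto
  have w': "of_int w' / of_int u \<in> ?R"
  proof (cases "p dvd u")
    case False
    have "of_int w' * inverse (of_int u) \<in> ?R" by (intro closed False)
    thus ?thesis by (simp add: divide_inverse)
  next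
    case True
    hence \<alpha>: "\<not> p dvd \<alpha>" using unit by simp
    hence a: "(of_int \<alpha> :: 'a) \<noteq> 0" by auto
    have "of_int u * of_int w'' = (of_int \<alpha> * of_int w' * of_int y + of_int \<beta> * (of_int w)\<^sup>2 :: 'a)"
      using arg_cong[OF rec, of "of_int :: int \<Rightarrow> 'a"] by simp
    hence "of_int w' / of_int u = (of_int w'' - of_int \<beta> * of_int w * (of_int w / of_int u))
        * inverse (of_int \<alpha>) * (inverse (of_int y) :: 'a)"
      using nz a by (simp add: field_simps power2_eq_square)
    moreover have "\<dots> \<in> ?R" by (intro closed le \<alpha> y)
    ultimately show ?thesis by simp
  qed
  have "i = ((of_int w' / of_int u) * of_int u'' + of_int \<beta> * (of_int w / of_int u) * of_int u')
      * inverse (of_int y)"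
    using i nz by (simp add: field_simps)
  moreover have "\<dots> \<in> ?R" by (intro closed le w' y)
  ultimately show ?thesis by simp
qed

text \<open>
  The situation is symmetric around \<open>y\<close>. If \<open>p\<close> divides both neighbours of \<open>y\<close>, then \<open>\<alpha>\<close> is a unit
  and the neighbour of smaller valuation plays the part of the divisor.
\<close>
lemma invariant_p_integral:
  fixes i :: "'a::field_char_0" and p :: int
  assumes p: "prime p" and y: "\<not> p dvd y" and nz: "u \<noteq> 0 \<or> w \<noteq> 0"
    and unit: "\<not> p dvd u \<or> \<not> p dvd w \<or> \<not> p dvd \<alpha>"
    and i: "i * of_int u * of_int y = of_int (w' * u'' + \<beta> * w * u')"
      "i * of_int w * of_int y = of_int (u' * w'' + \<beta> * u * w')"
    and rec: "u * w'' = \<alpha> * w' * y + \<beta> * w\<^sup>2" "w * u'' = \<alpha> * u' * y + \<beta> * u\<^sup>2"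
  shows "i \<in> p_integral p"
proof -
  have *: "of_int a / of_int b \<in> (p_integral p :: 'a set)" if "\<not> p dvd b" for a b
    using subring_setD(4)[OF subring_p_integral[OF p] of_int_p_integral[OF p] inverse_p_integral[OF that]]
    by (simp add: divide_inverse)
  note left = invariant_p_integral_aux[OF p y _ _ _ i(1) rec(1)]
  note right = invariant_p_integral_aux[OF p y _ _ _ i(2) rec(2)]
  show ?thesis
  proof (cases "p dvd u \<and> p dvd w")
    case False
    thus ?thesis using * left right by (metis dvd_0_right)
  next
    case True
    hence "\<not> p dvd \<alpha>" using unit by simp
    thus ?thesis using p_integral_total[OF p nz, where 'a = 'a] left right by blast
  qed
qed

section \<open>Integrality of the sequence\<close>

theorem theorem3p6:
  fixes \<alpha> \<beta> :: int and x1 x2 x3 x4 :: "'a::field_char_0"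
    and A :: "int \<Rightarrow> 'a" and k :: "int \<Rightarrow> int"
  assumes A_def: "A = somos4 (of_int \<alpha>) (of_int \<beta>) x1 x2 x3 x4"
    and nonzero: "x1 \<noteq> 0" "x2 \<noteq> 0" "x3 \<noteq> 0" "x4 \<noteq> 0"
    and eight_terms: "\<forall>n\<in>{-2..5}. A n = of_int (k n)"
    and gcds: "gcd \<alpha> \<beta> = 1" "gcd (k 1) (k 2) = 1"
      "Gcd {\<alpha>, k 0, k 2} = 1" "Gcd {\<alpha>, k 1, k 3} = 1"
  shows "\<forall>n. A n \<in> \<int>"
proof
  fix n
  define h :: "pol6 \<Rightarrow> 'a" where "h = eval6 (of_int \<alpha>) (of_int \<beta>) x1 x2 x3 x4"
  have hom: "is_ring_hom h" unfolding h_def by (rule is_ring_hom_eval6)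
  note ar = fract_value_arith[OF hom] fract_value_power[OF hom]
  have val: "fract_value h f\<alpha> (of_int \<alpha>)" "fract_value h f\<beta> (of_int \<beta>)"
    using fract_value_to_fract[OF hom, of var_alpha] fract_value_to_fract[OF hom, of var_beta]
    by (simp_all add: h_def)
  have value_ratfun: "ratfun_value (of_int \<alpha>) (of_int \<beta>) x1 x2 x3 x4 f = v" if "fract_value h f v" for f v
    using that ratfun_value_eq unfolding fract_value_def h_def by blast
  have value_unique: "v = w" if "fract_value h f v" "fract_value h f w" for f v w
    using value_ratfun[OF that(1)] value_ratfun[OF that(2)] by simp
  have A_value: "A n = v" if "fract_value h (F n) v" for n v
    using value_ratfun[OF that] by (simp add: A_def somos4_def)
  have init: "A 1 = x1" "A 2 = x2" "A 3 = x3" "A 4 = x4"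
    unfolding A_def by (simp_all add: somos4_init)
  have k_init: "x1 = of_int (k 1)" "x2 = of_int (k 2)" "x3 = of_int (k 3)" "x4 = of_int (k 4)"
    using eight_terms init by auto
  have k_nz: "k 1 \<noteq> 0" "k 2 \<noteq> 0" "k 3 \<noteq> 0" "k 4 \<noteq> 0"
    using nonzero k_init by auto
  have kval: "fract_value h (F n) (of_int (k n))" if "fract_value h (F n) v" "n \<in> {-2..5}" for n v
    using A_value[OF that(1)] that eight_terms by auto
  have F14: "fract_value h (F 1) (of_int (k 1))" "fract_value h (F 2) (of_int (k 2))"
    "fract_value h (F 3) (of_int (k 3))" "fract_value h (F 4) (of_int (k 4))"
    using fract_value_to_fract[OF hom, of var_A1] fract_value_to_fract[OF hom, of var_A2]
      fract_value_to_fract[OF hom, of var_A3] fract_value_to_fract[OF hom, of var_A4]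
    by (simp_all add: h_def somos4_formal_init k_init[symmetric])
  have k_nz': "(of_int (k 1) :: 'a) \<noteq> 0" "(of_int (k 2) :: 'a) \<noteq> 0" "(of_int (k 3) :: 'a) \<noteq> 0"
    "(of_int (k 4) :: 'a) \<noteq> 0" using k_nz by auto
  \<comment> \<open>The four terms next to the initial data have only initial data as denominators, so they have
    values at the given point; further away a denominator may vanish there.\<close>
  have quot: "F 5 = (f\<alpha> * F 4 * F 2 + f\<beta> * (F 3)\<^sup>2) / F 1" "F 0 = (f\<alpha> * F 3 * F 1 + f\<beta> * (F 2)\<^sup>2) / F 4"
    "F (-1) = (f\<alpha> * F 2 * F 0 + f\<beta> * (F 1)\<^sup>2) / F 3" "F (-2) = (f\<alpha> * F 1 * F (-1) + f\<beta> * (F 0)\<^sup>2) / F 2"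
    using somos4_formal_rec[of 1] somos4_formal_rec[of 0] somos4_formal_rec[of "-1"]
      somos4_formal_rec[of "-2"] somos4_formal_nonzero
    by (simp_all add: eq_divide_eq mult.commute)
  have quot_val: "fract_value h (F m) (of_int (k m))"
    if "F m = (f\<alpha> * F a * F b + f\<beta> * (F c)\<^sup>2) / F d"
      "fract_value h (F a) (of_int (k a))" "fract_value h (F b) (of_int (k b))"
      "fract_value h (F c) (of_int (k c))" "fract_value h (F d) (of_int (k d))"
      "(of_int (k d) :: 'a) \<noteq> 0" "m \<in> {-2..5}" for m a b c d
  proof (rule kval)
    show "fract_value h (F m) ((of_int \<alpha> * of_int (k a) * of_int (k b) + of_int \<beta> * (of_int (k c))\<^sup>2)
        / of_int (k d))"
      unfolding that(1) by (intro ar val that)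
  qed (fact that)
  have F5: "fract_value h (F 5) (of_int (k 5))"
    by (rule quot_val[OF quot(1) F14(4,2,3,1) k_nz'(1)]) simp
  have F0: "fract_value h (F 0) (of_int (k 0))"
    by (rule quot_val[OF quot(2) F14(3,1,2,4) k_nz'(4)]) simp
  have Fm1: "fract_value h (F (-1)) (of_int (k (-1)))"
    by (rule quot_val[OF quot(3) F14(2) F0 F14(1,3) k_nz'(3)]) simp
  have Fm2: "fract_value h (F (-2)) (of_int (k (-2)))"
    by (rule quot_val[OF quot(4) F14(1) Fm1 F0 F14(2) k_nz'(2)]) simp
  note F_val = Fm2 Fm1 F0 F14 F5
  have F: "fract_value h (F m) (of_int (k m))" if "m \<in> {-2..5}" for m
  proof -
    have "m \<in> {-2, -1, 0, 1, 2, 3, 4, 5}" using that by auto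
    thus ?thesis using F_val by auto
  qed
  have rec: "k (n + 4) * k n = \<alpha> * k (n + 3) * k (n + 1) + \<beta> * (k (n + 2))\<^sup>2"
    if "n \<in> {-2, -1, 0, 1}" for n
  proof -
    have "fract_value h (F (n + 4) * F n) (of_int (k (n + 4)) * of_int (k n))"
      by (intro ar F) (use that in auto)
    moreover have "fract_value h (F (n + 4) * F n) (of_int \<alpha> * of_int (k (n + 3)) * of_int (k (n + 1))
        + of_int \<beta> * (of_int (k (n + 2)))\<^sup>2)"
      unfolding somos4_formal_rec by (intro ar F val) (use that in auto)
    ultimately have "(of_int (k (n + 4) * k n) :: 'a)
        = of_int (\<alpha> * k (n + 3) * k (n + 1) + \<beta> * (k (n + 2))\<^sup>2)"
      using value_unique by fastforce
    thus ?thesis by (simp only: of_int_eq_iff)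
  qed
  let ?I = "f\<alpha>\<^sup>2 + f\<beta> * formal_T"
  define i :: 'a where "i = (of_int (k 4) * of_int (k (-1)) + of_int \<beta> * of_int (k 3) * of_int (k 0))
    / (of_int (k 2) * of_int (k 1))"
  have I: "fract_value h ?I i"
  proof -
    have "?I = (F 4 * F (-1) + f\<beta> * F 3 * F 0) / (F 2 * F 1)"
      using formal_somos5[of "-1"] somos4_formal_nonzero by (simp add: eq_divide_eq mult.assoc)
    also have "fract_value h \<dots> i"
      unfolding i_def by (intro ar val F_val) (use k_nz' in auto)
    finally show ?thesis .
  qed
  have somos5: "i * of_int (k (n + 3)) * of_int (k (n + 2)) = of_int (k (n + 5) * k n + \<beta> * k (n + 4) * k (n + 1))"
    if "n \<in> {-2, -1, 0}" for n
  proof -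
    have "fract_value h (F (n + 5) * F n) (of_int (k (n + 5)) * of_int (k n))"
      by (intro ar F) (use that in auto)
    moreover have "fract_value h (F (n + 5) * F n) (i * of_int (k (n + 3)) * of_int (k (n + 2))
        - of_int \<beta> * of_int (k (n + 4)) * of_int (k (n + 1)))"
      unfolding formal_somos5 by (intro ar F val I) (use that in auto)
    ultimately have "of_int (k (n + 5)) * of_int (k n) = i * of_int (k (n + 3)) * of_int (k (n + 2))
        - of_int \<beta> * of_int (k (n + 4)) * of_int (k (n + 1))"
      by (rule value_unique)
    thus ?thesis by simp
  qed
  show "A n \<in> \<int>"
  proof (rule Ints_if_p_integral)
    fix p :: int
    assume p: "prime p"
    have common: "\<not> (p dvd a \<and> p dvd b)" if "gcd a b = 1" for a b
      using that p not_prime_unit by (metis gcd_greatest)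
    have common3: "\<not> (p dvd a \<and> p dvd b \<and> p dvd c)" if "Gcd {a, b, c} = 1" for a b c
    proof
      assume "p dvd a \<and> p dvd b \<and> p dvd c"
      hence "p dvd Gcd {a, b, c}" by (intro Gcd_greatest) auto
      thus False using that p not_prime_unit by metis
    qed
    \<comment> \<open>The seven terms centred at 2 are those of index \<open>-1, ..., 5\<close>; those centred at 1 have index
      \<open>-2, ..., 4\<close>. The third gcd condition concerns the neighbours of 1, the fourth those of 2.\<close>
    have "\<exists>j\<in>{1, 2}. \<not> p dvd k j \<and> i \<in> p_integral p"
    proof (cases "p dvd k 2")
      case False
      have "i \<in> p_integral p"
        by (rule invariant_p_integral[OF p False, where u = "k 1" and w = "k 3" and \<alpha> = \<alpha> and \<beta> = \<beta>
              and u' = "k 0" and w' = "k 4" and u'' = "k (-1)" and w'' = "k 5"])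
          (use k_nz common3[OF gcds(4)] somos5[of "-1"] somos5[of 0] rec[of 1] rec[of "-1"]
            in \<open>auto simp: mult_ac\<close>)
      thus ?thesis using False by blast
    next
      case True
      hence p1: "\<not> p dvd k 1" using common[OF gcds(2)] by auto
      have "i \<in> p_integral p"
        by (rule invariant_p_integral[OF p p1, where u = "k 2" and w = "k 0" and \<alpha> = \<alpha> and \<beta> = \<beta>
              and u' = "k 3" and w' = "k (-1)" and u'' = "k 4" and w'' = "k (-2)"])
          (use k_nz common3[OF gcds(3)] somos5[of "-1"] somos5[of "-2"] rec[of 0] rec[of "-2"]
            in \<open>auto simp: mult_ac\<close>)
      thus ?thesis using p1 by blast
    qed
    then obtain j where j: "j = 1 \<or> j = 2" "\<not> p dvd k j" and i: "i \<in> p_integral p" by blast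
    define S where "S = {f. \<exists>v\<in>p_integral p. fract_value h f v}"
    have S: "f \<in> S" if "fract_value h f (of_int m)" for f m
      using that of_int_p_integral[OF p] by (auto simp: S_def)
    have "F n \<in> S"
    proof (rule formal_terms_in_subring)
      show "subring_set S" unfolding S_def by (rule fract_value_subring[OF hom subring_p_integral[OF p]])
      show "f\<alpha> \<in> S" "f\<beta> \<in> S" by (rule S, rule val)+
      show "?I \<in> S" using I i by (auto simp: S_def)
      have one: "fract_value h 1 1"
        using fract_value_to_fract[OF hom, of 1] by (simp add: hom_simps[OF hom])
      have "fract_value h (1 / F j) (1 / of_int (k j))"
        using j k_nz' F14 by (auto intro!: ar one)
      thus "inverse (F j) \<in> S"
        using inverse_p_integral[OF j(2)] by (auto simp: S_def inverse_eq_divide)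
      show "F (j + m) \<in> S" if "m \<in> {-3..3}" for m
        by (rule S, rule F) (use that j(1) in auto)
    qed
    thus "A n \<in> p_integral p" using A_value by (auto simp: S_def)
  qed
qed

end
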